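(* Let $G$ be a connected graph of order $n\ge 3$ with minimum degree $\delta$ and maximum degree $\Delta$. Then $$\gamma_{t,coi}(G)\geq \frac{n\delta}{\Delta+\delta-1}.$$
   Context: All graphs are finite, simple and undirected. A set $D\subseteq V(G)$ is a total dominating set of $G$ if every vertex of $V(G)$ is adjacent to at least one vertex of $D$. A total dominating set $D$ is a total co-independent dominating set (TC-ID set) if $V(G)\setminus D$ is nonempty and independent. The total co-independent domination number $\gamma_{t,coi}(G)$ is the minimum cardinality of a TC-ID set of $G$. *)

theory Defs
  imports Complex_Main "Graph_Theory.Graph_Theory"
begin

text \<open>
  Finite simple undirected graphs are the \<open>pair_graph\<close>s of the Graph_Theory library: finite
  loop-free digraphs without parallel arcs whose arc relation is symmetric. Every edge is thus
  represented by its two arcs, so that the degree of a vertex is its \<open>out_degree\<close>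
  (equivalently, its \<open>in_degree\<close>).
\<close>

definition min_degree :: "'a pair_pre_digraph \<Rightarrow> nat" where
  "min_degree G = Min (out_degree (with_proj G) ` pverts G)"

definition max_degree :: "'a pair_pre_digraph \<Rightarrow> nat" where
  "max_degree G = Max (out_degree (with_proj G) ` pverts G)"

definition independent_set :: "'a pair_pre_digraph \<Rightarrow> 'a set \<Rightarrow> bool" where
  "independent_set G S \<longleftrightarrow>
    S \<subseteq> pverts G \<and> (\<forall>u\<in>S. \<forall>v\<in>S. \<not> u \<rightarrow>\<^bsub>with_proj G\<^esub> v)"

definition total_dominating_set :: "'a pair_pre_digraph \<Rightarrow> 'a set \<Rightarrow> bool" where
  "total_dominating_set G D \<longleftrightarrow>
    D \<subseteq> pverts G \<and> (\<forall>v\<in>pverts G. \<exists>u\<in>D. v \<rightarrow>\<^bsub>with_proj G\<^esub> u)"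

definition tcid_set :: "'a pair_pre_digraph \<Rightarrow> 'a set \<Rightarrow> bool" where
  "tcid_set G D \<longleftrightarrow>
    total_dominating_set G D \<and> pverts G - D \<noteq> {} \<and> independent_set G (pverts G - D)"

text \<open>
  The minimum below is meaningful only if a total co-independent dominating set exists. This is the
  case for every connected graph of order at least 3: remove a single vertex, which is chosen to be
  a leaf if there is one.
\<close>

definition tcid_number :: "'a pair_pre_digraph \<Rightarrow> nat" where
  "tcid_number G = Min (card ` {D. tcid_set G D})"

end

(* For a TC-ID set D with complement S, double count the edges between S and D. Since S is
   independent, every vertex of S sends all of its at least \<delta> edges to D; since D is total
   dominating, every vertex of D spends one of its at most \<Delta> edges inside D. Hence
   \<delta> (n - |D|) \<le> (\<Delta> - 1) |D|. *)
theory Submission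
  imports Defs
begin

context pair_graph
begin

lemma min_degree_le: "v \<in> pverts G \<Longrightarrow> min_degree G \<le> out_degree (with_proj G) v"
  unfolding min_degree_def by (simp add: pair_finite_verts)

lemma max_degree_ge: "v \<in> pverts G \<Longrightarrow> out_degree (with_proj G) v \<le> max_degree G"
  unfolding max_degree_def by (simp add: pair_finite_verts)

text \<open>This is the double counting estimate with \<open>card D\<close> moved to the left, so
  that neither n - |D| nor \<Delta> - 1 appears as a truncated subtraction of naturals.\<close>

lemma card_tcid_set_bound:
  assumes "tcid_set G D"
  shows "card (pverts G) * min_degree G + card D \<le> card D * (max_degree G + min_degree G)"
proof -
  let ?S = "pverts G - D"
  let ?out = "out_arcs (with_proj G)"
  let ?cross = "\<lambda>u. {e \<in> ?out u. snd e \<in> ?S}"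
  have D: "D \<subseteq> pverts G" and dom: "\<And>v. v \<in> pverts G \<Longrightarrow> \<exists>u\<in>D. (v, u) \<in> parcs G"
    and ind: "\<And>u v. u \<in> ?S \<Longrightarrow> v \<in> ?S \<Longrightarrow> (u, v) \<notin> parcs G"
    using assms unfolding tcid_set_def total_dominating_set_def independent_set_def by auto
  have fin: "finite D" "finite ?S"
    using D pair_finite_verts by (auto intro: finite_subset)
  have out: "?out u = {e \<in> parcs G. fst e = u}" for u
    by (auto simp: out_arcs_def)
  have finout: "finite (?out u)" for u
    by (simp add: out pair_finite_arcs)
  have "card ?S * min_degree G \<le> (\<Sum>v\<in>?S. card (?out v))"
    using sum_bounded_below[of ?S "min_degree G" "\<lambda>v. card (?out v)"] min_degree_le
    by (simp add: out_degree_def)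
  also have "\<dots> = card (\<Union>v\<in>?S. ?out v)"
    by (rule card_UN_disjoint[symmetric]) (use fin finout in \<open>auto simp: out\<close>)
  \<comment> \<open>Reversing arcs matches the arcs leaving \<open>?S\<close> with the arcs from
    \<open>D\<close> into \<open>?S\<close>: independence of \<open>?S\<close> forces the head of
    each arc leaving it to lie in \<open>D\<close>.\<close>
  also have "(\<Union>v\<in>?S. ?out v) = prod.swap ` (\<Union>u\<in>D. ?cross u)"
  proof (intro equalityI subsetI)
    fix e assume "e \<in> (\<Union>v\<in>?S. ?out v)"
    then obtain v u where e: "e = (v, u)" "(v, u) \<in> parcs G" "v \<in> ?S"
      by (cases e) (auto simp: out)
    then have "u \<in> D"
      using ind[of v u] in_arcsD2 by auto
    then have "(u, v) \<in> (\<Union>u\<in>D. ?cross u)"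
      using e arcs_symmetric[of v u] by (auto simp: out)
    then show "e \<in> prod.swap ` (\<Union>u\<in>D. ?cross u)"
      using e(1) by (intro image_eqI[of _ _ "(u, v)"]) simp_all
  next
    fix e assume "e \<in> prod.swap ` (\<Union>u\<in>D. ?cross u)"
    then obtain u v where "e = (v, u)" "(u, v) \<in> parcs G" "v \<in> ?S"
      by (auto simp: out)
    then show "e \<in> (\<Union>v\<in>?S. ?out v)"
      using arcs_symmetric[of u v] by (auto simp: out)
  qed
  also have "card \<dots> = card (\<Union>u\<in>D. ?cross u)"
    by (rule card_image) simp
  also have "\<dots> = (\<Sum>u\<in>D. card (?cross u))"
    by (rule card_UN_disjoint) (use fin finout in \<open>auto simp: out\<close>)
  \<comment> \<open>The summand \<open>card D\<close> gives each vertex of \<open>D\<close> one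
    extra unit, which pays for a neighbour inside \<open>D\<close>.\<close>
  finally have "card ?S * min_degree G + card D \<le> (\<Sum>u\<in>D. card (?cross u) + 1)"
    by (simp add: sum_Suc)
  also have "\<dots> \<le> card D * max_degree G"
  proof -
    have "card (?cross u) + 1 \<le> max_degree G" if "u \<in> D" for u
    proof -
      have u: "u \<in> pverts G" using that D by auto
      then obtain w where "w \<in> D" "(u, w) \<in> parcs G" using dom by blast
      \<comment> \<open>The arc to the dominating neighbour \<open>w\<close> is the one that makes
        the inclusion strict and so saves 1 in the count at \<open>u\<close>.\<close>
      then have "(u, w) \<in> ?out u" "(u, w) \<notin> ?cross u" by (auto simp: out)
      then have "?cross u \<subset> ?out u" by blast
      then have "card (?cross u) < card (?out u)"
        using finout by (rule psubset_card_mono[rotated])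
      then show ?thesis
        using max_degree_ge[OF u] by (simp add: out_degree_def)
    qed
    then show ?thesis
      using sum_bounded_above[of D "\<lambda>u. card (?cross u) + 1" "max_degree G"] by simp
  qed
  finally have "card ?S * min_degree G + card D \<le> card D * max_degree G" .
  moreover have "card (pverts G) = card ?S + card D"
    using D fin card_Diff_subset[of D "pverts G"] card_mono[OF pair_finite_verts D] by simp
  ultimately show ?thesis
    by (simp add: algebra_simps)
qed

text \<open>Arcs come in both directions, so connectedness makes every vertex reachable from
  \<open>x\<close>, and membership in \<open>S\<close> propagates along the walk. It serves to show
  that a small closed set would be the whole graph, against the bound on the order.\<close>

lemma connected_closed_eq_pverts:
  assumes "Digraph_Component.connected (with_proj G)"
    and "x \<in> S" and "S \<subseteq> pverts G"
    and closed: "\<And>u v. u \<in> S \<Longrightarrow> (u, v) \<in> parcs G \<Longrightarrow> v \<in> S"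
  shows "S = pverts G"
proof -
  have "v \<in> S" if "v \<in> pverts G" for v
  proof -
    have "strongly_connected (with_proj G)"
      using symmetric_connected_imp_strongly_connected pair_sym_arcs assms(1) by blast
    then have "x \<rightarrow>\<^sup>*\<^bsub>with_proj G\<^esub> v"
      using assms(2,3) that by (auto simp: strongly_connected_def)
    then show ?thesis
      by (induction rule: reachable_induct) (use assms(2) closed in auto)
  qed
  then show ?thesis using assms(3) by blast
qed

lemma ex_neighbour:
  assumes "Digraph_Component.connected (with_proj G)" and "card (pverts G) \<ge> 2"
    and "v \<in> pverts G"
  shows "\<exists>u. (v, u) \<in> parcs G"
proof (rule ccontr)
  assume "\<not> ?thesis"
  then have "{v} = pverts G"
    using assms(1,3) by (intro connected_closed_eq_pverts[of v]) auto
  then have "card (pverts G) = card {v}" by simp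
  then show False using assms(2) by simp
qed

text \<open>A single vertex is independent because there are no loops, so only total domination has
  to be secured by the second hypothesis.\<close>

lemma tcid_set_remove_vertex:
  assumes "w \<in> pverts G"
    and "\<And>v. v \<in> pverts G \<Longrightarrow> \<exists>u. u \<noteq> w \<and> (v, u) \<in> parcs G"
  shows "tcid_set G (pverts G - {w})"
proof -
  have compl: "pverts G - (pverts G - {w}) = {w}" using assms(1) by auto
  have "independent_set G {w}"
    using assms(1) no_loops'[of w w] by (auto simp: independent_set_def)
  moreover have "total_dominating_set G (pverts G - {w})"
    unfolding total_dominating_set_def
  proof (intro conjI ballI)
    fix v assume "v \<in> pverts G"
    then obtain u where "u \<noteq> w" "(v, u) \<in> parcs G" using assms(2) by blast
    then show "\<exists>u\<in>pverts G - {w}. v \<rightarrow>\<^bsub>with_proj G\<^esub> u"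
      using in_arcsD2[of v u] by (intro bexI[of _ u]) simp_all
  qed simp
  ultimately show ?thesis
    by (simp add: tcid_set_def compl)
qed

text \<open>Without existence, \<open>tcid_number\<close> would be the minimum of an empty set. The
  witness omits one vertex: a leaf if there is one, any vertex otherwise.\<close>

lemma ex_tcid_set:
  assumes conn: "Digraph_Component.connected (with_proj G)" and card: "card (pverts G) \<ge> 3"
  shows "\<exists>D. tcid_set G D"
proof -
  have nb: "\<exists>u. (v, u) \<in> parcs G" if "v \<in> pverts G" for v
    using ex_neighbour[OF conn _ that] card by simp
  show ?thesis
  \<comment> \<open>Since \<open>nb\<close> supplies a neighbour, the condition says that
    \<open>x\<close> is a leaf attached to \<open>y\<close>.\<close>
  proof (cases "\<exists>x y. x \<in> pverts G \<and> (\<forall>u. (x, u) \<in> parcs G \<longrightarrow> u = y)")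
    case True
    then obtain x y where x: "x \<in> pverts G" "\<And>u. (x, u) \<in> parcs G \<Longrightarrow> u = y" by blast
    have xy: "(x, y) \<in> parcs G" using nb[OF x(1)] x(2) by blast
    have "\<exists>u. u \<noteq> x \<and> (v, u) \<in> parcs G" if v: "v \<in> pverts G" for v
    proof (rule ccontr)
      assume "\<not> ?thesis"
      then have only: "\<And>u. (v, u) \<in> parcs G \<Longrightarrow> u = x" by blast
      then have "(v, x) \<in> parcs G" using nb[OF v] by blast
      \<comment> \<open>A vertex whose only neighbour is the leaf \<open>x\<close> must be
        \<open>y\<close>. Then \<open>{x, y}\<close> is closed under adjacency and exhausts the
        graph, contradicting order at least 3.\<close>
      then have "v = y" using x(2) arcs_symmetric by blast
      then have "{x, y} = pverts G"
        using only x(2) v by (intro connected_closed_eq_pverts[OF conn, of x]) (use x(1) in auto)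
      then have "card (pverts G) = card {x, y}" by simp
      also have "\<dots> \<le> 2" by (simp add: card_insert_if)
      finally show False using card by simp
    qed
    then show ?thesis using tcid_set_remove_vertex[OF x(1)] by blast
  next
    case False
    obtain w where "w \<in> pverts G" using card by fastforce
    \<comment> \<open>Without leaves, no vertex has \<open>w\<close> as its only neighbour.\<close>
    then show ?thesis using tcid_set_remove_vertex[of w] False by blast
  qed
qed

lemma tcid_number_attained:
  assumes "Digraph_Component.connected (with_proj G)" and "card (pverts G) \<ge> 3"
  obtains D where "tcid_set G D" and "card D = tcid_number G"
proof -
  have "{D. tcid_set G D} \<subseteq> Pow (pverts G)"
    unfolding tcid_set_def total_dominating_set_def by auto
  then have "finite {D. tcid_set G D}"
    using pair_finite_verts by (metis finite_Pow_iff finite_subset)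
  then have "tcid_number G \<in> card ` {D. tcid_set G D}"
    unfolding tcid_number_def using ex_tcid_set[OF assms] by (intro Min_in) auto
  then show ?thesis using that by auto
qed

end

theorem proposition14:
  fixes G :: "'a pair_pre_digraph"
    and n \<delta> \<Delta> :: nat
  assumes "pair_graph G"
    and "Digraph_Component.connected (with_proj G)"
    and "n = card (pverts G)"
    and "n \<ge> 3"
    and "\<delta> = min_degree G"
    and "\<Delta> = max_degree G"
  shows "real (tcid_number G) \<ge> (real n * real \<delta>) / (real \<Delta> + real \<delta> - 1)"
proof -
  interpret pair_graph G by fact
  obtain D where D: "tcid_set G D" "card D = tcid_number G"
    using tcid_number_attained assms by metis
  have "n * \<delta> + tcid_number G \<le> tcid_number G * (\<Delta> + \<delta>)"
    using card_tcid_set_bound[OF D(1)] D(2) assms by simp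
  then have "real (n * \<delta> + tcid_number G) \<le> real (tcid_number G * (\<Delta> + \<delta>))"
    by (rule of_nat_mono)
  then have bound: "real n * real \<delta> \<le> real (tcid_number G) * (real \<Delta> + real \<delta> - 1)"
    by (simp add: algebra_simps)
  show ?thesis
  proof (cases "\<Delta> + \<delta> > 1")
    case True
    then have "real \<Delta> + real \<delta> - 1 > 0" by linarith
    then show ?thesis using bound by (simp add: pos_divide_le_eq)
  next
    \<comment> \<open>Here the quotient is 0: either its numerator vanishes, or its denominator does
      and division by zero yields 0.\<close>
    case False
    then have "\<delta> = 0 \<or> \<Delta> + \<delta> = 1" by auto
    then have "real \<delta> = 0 \<or> real \<Delta> + real \<delta> - 1 = 0" by linarith
    then show ?thesis by auto
  qed
qed

end
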